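(* Let $\mathbf{G}$ be a semigroup which is right cancellative and in which, for all $a, b \in \mathbf{G}$, the equation $aX = b$ has infinitely many solutions $X \in \mathbf{G}$. Let $P \in \mathbf{G}$ and let $\mathbf{G}P = \{GP : G \in \mathbf{G}\}$ (a subsemigroup of $\mathbf{G}$) and $P\mathbf{G} = \{PG : G\in\mathbf{G}\} = \mathbf{G}$. Then $\mathbf{G}P$ is generally (infinite-to-one) isomorphic with $P\mathbf{G} = \mathbf{G}$; that is, there is a surjective semigroup homomorphism $\varphi: \mathbf{G}P \to \mathbf{G}$ such that for every $Q \in \mathbf{G}$ the fibre $\varphi^{-1}(Q)$ is infinite.
   Context: A semigroup is a non-empty set with an associative binary operation. Right cancellative means: $xa = ya$ implies $x = y$ for all $a,x,y$. A "generalised isomorphism" means an infinite-to-one homomorphism onto the target. *)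

theory Defs
  imports "HOL-Algebra.Coset"
begin

text \<open>
  HOL-Algebra has no locale for semigroups on a carrier set. We use its monoid records, so that
  its homomorphisms (\<^const>\<open>hom\<close>, \<^const>\<open>epi\<close>) and translates (\<^const>\<open>r_coset\<close>, \<^const>\<open>l_coset\<close>)
  are available; the field \<^const>\<open>one\<close> of the record is left unconstrained and plays no role.
\<close>

locale carrier_semigroup =
  fixes G (structure)
  assumes carrier_nonempty: "carrier G \<noteq> {}"
    and m_closed: "\<lbrakk>x \<in> carrier G; y \<in> carrier G\<rbrakk> \<Longrightarrow> x \<otimes> y \<in> carrier G"
    and m_assoc: "\<lbrakk>x \<in> carrier G; y \<in> carrier G; z \<in> carrier G\<rbrakk>
      \<Longrightarrow> (x \<otimes> y) \<otimes> z = x \<otimes> (y \<otimes> z)"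

definition subsemigroup :: "'a set \<Rightarrow> ('a, 'm) monoid_scheme \<Rightarrow> bool" where
  "subsemigroup H G \<longleftrightarrow> H \<subseteq> carrier G \<and> carrier_semigroup (G\<lparr>carrier := H\<rparr>)"

definition right_cancellative :: "('a, 'm) monoid_scheme \<Rightarrow> bool" where
  "right_cancellative G \<longleftrightarrow>
    (\<forall>a\<in>carrier G. \<forall>x\<in>carrier G. \<forall>y\<in>carrier G.
      x \<otimes>\<^bsub>G\<^esub> a = y \<otimes>\<^bsub>G\<^esub> a \<longrightarrow> x = y)"

text \<open>The relation is directed: the infinite-to-one homomorphism goes from \<open>H\<close> onto \<open>G\<close>.\<close>

definition generally_isomorphic ::
  "('a, 'm) monoid_scheme \<Rightarrow> ('b, 'n) monoid_scheme \<Rightarrow> bool" where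
  "generally_isomorphic H G \<longleftrightarrow>
    (\<exists>\<phi>\<in>epi H G. \<forall>Q\<in>carrier G. infinite {x \<in> carrier H. \<phi> x = Q})"

end

(* Right cancellation makes X P determine X, so X P |-> P X is a well-defined map on G P; it is
   a homomorphism because both (X P)(Y P) = (X P Y) P and P (X P Y) = (P X)(P Y). Its fibre over
   Q is the injective image, under X |-> X P, of the infinite solution set of P X = Q. *)

theory Submission
  imports Defs
begin

theorem mainTheorem2:
  fixes G :: "('a, 'm) monoid_scheme" (structure) and P :: 'a
  assumes "carrier_semigroup G"
    and "right_cancellative G"
    and "\<And>a b. \<lbrakk>a \<in> carrier G; b \<in> carrier G\<rbrakk> \<Longrightarrow> infinite {X \<in> carrier G. a \<otimes> X = b}"
    and "P \<in> carrier G"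
  shows "subsemigroup (carrier G #> P) G
    \<and> P <# carrier G = carrier G
    \<and> generally_isomorphic (G\<lparr>carrier := carrier G #> P\<rparr>) G"
proof -
  interpret carrier_semigroup G by fact
  note P = \<open>P \<in> carrier G\<close>
  have coset: "carrier G #> P = (\<lambda>X. X \<otimes> P) ` carrier G"
    by (auto simp: r_coset_def)
  have inj: "inj_on (\<lambda>X. X \<otimes> P) (carrier G)"
    using assms(2) P by (auto simp: right_cancellative_def inj_on_def)
  \<comment> \<open>An infinite solution set is in particular nonempty.\<close>
  have solvable: "\<exists>X\<in>carrier G. P \<otimes> X = Q" if "Q \<in> carrier G" for Q
    using assms(3)[OF P that] by (metis (mono_tags, lifting) empty_Collect_eq finite.emptyI)
  \<comment> \<open>This bracketing displays the product as the right translate of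
    \<open>X \<otimes> P \<otimes> Y\<close>: it gives closure of the translates, and
    \<open>\<phi>\<close> can be evaluated on it.\<close>
  have mult: "(X \<otimes> P) \<otimes> (Y \<otimes> P) = (X \<otimes> P \<otimes> Y) \<otimes> P"
    if "X \<in> carrier G" "Y \<in> carrier G" for X Y
    using that P by (simp add: m_assoc m_closed)
  have subset: "carrier G #> P \<subseteq> carrier G"
    using P by (auto simp: coset m_closed)
  have "x \<otimes> y \<in> carrier G #> P" if "x \<in> carrier G #> P" "y \<in> carrier G #> P" for x y
    using that P by (auto simp: coset mult m_closed)
  with subset have sub: "subsemigroup (carrier G #> P) G"
    using carrier_nonempty
    by (auto simp: subsemigroup_def carrier_semigroup_def coset subset_iff intro!: m_assoc)
  have onto: "P <# carrier G = carrier G"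
    using solvable P by (fastforce simp: l_coset_def m_closed)
  \<comment> \<open>By \<open>inj\<close> the chosen preimage of a translate is the only one. Values
    of \<open>\<phi>\<close> at other points are arbitrary.\<close>
  define \<phi> where "\<phi> x = P \<otimes> inv_into (carrier G) (\<lambda>X. X \<otimes> P) x" for x
  have \<phi>: "\<phi> (X \<otimes> P) = P \<otimes> X" if "X \<in> carrier G" for X
    using inv_into_f_f[OF inj that] by (simp add: \<phi>_def)
  \<comment> \<open>Associativity is held back until \<open>mult\<close> and \<open>\<phi>\<close>
    have been applied, since rebracketing first would hide the form
    \<open>X \<otimes> P\<close>.\<close>
  have "\<phi> \<in> hom (G\<lparr>carrier := carrier G #> P\<rparr>) G"
    using P by (auto simp: hom_def coset \<phi> mult m_closed) (simp add: m_assoc m_closed)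
  \<comment> \<open>The values of \<open>\<phi>\<close> on the translates are the products
    \<open>P \<otimes> X\<close>, so its image is \<open>P <# carrier G\<close>.\<close>
  moreover have "\<phi> ` (carrier G #> P) = carrier G"
    using onto by (auto simp: coset image_image \<phi> l_coset_def)
  moreover have "infinite {x \<in> carrier G #> P. \<phi> x = Q}" if "Q \<in> carrier G" for Q
  proof -
    have "{x \<in> carrier G #> P. \<phi> x = Q} = (\<lambda>X. X \<otimes> P) ` {X \<in> carrier G. P \<otimes> X = Q}"
      by (auto simp: coset \<phi>)
    moreover have "inj_on (\<lambda>X. X \<otimes> P) {X \<in> carrier G. P \<otimes> X = Q}"
      using inj by (rule inj_on_subset) auto
    ultimately show ?thesis
      using assms(3)[OF P that] by (simp add: finite_image_iff)
  qed
  ultimately have "generally_isomorphic (G\<lparr>carrier := carrier G #> P\<rparr>) G"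
    unfolding generally_isomorphic_def epi_def by auto
  with sub onto show ?thesis by blast
qed

end
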